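(* Let $(X,d,\preceq)$ be an ordered metric space, $E$ a subspace of $X$, $\ast\in\mathfrak B_n$, and let $F:X^n\to X$ and $g:X\to X$ be two mappings. Suppose that $F(X^n)\subseteq g(X)\cap E$, that $F$ has the $g$-monotone property, and that there exists $\varphi\in\Omega$ such that at least one of the following two contractivity conditions holds for all $x_1,\dots,x_n,y_1,\dots,y_n\in X$ with [$g(x_i)\preceq g(y_i)$ for each $i\in I_n$] or [$g(x_i)\succeq g(y_i)$ for each $i\in I_n$]: $$\frac1n\sum_{i=1}^n d\big(F(x_{i_1},\dots,x_{i_n}),F(y_{i_1},\dots,y_{i_n})\big)\le\varphi\Big(\frac1n\sum_{i=1}^n d(gx_i,gy_i)\Big),$$ or alternatively $$\max_{i\in I_n} d\big(F(x_{i_1},\dots,x_{i_n}),F(y_{i_1},\dots,y_{i_n})\big)\le\varphi\Big(\max_{i\in I_n} d(gx_i,gy_i)\Big).$$ Suppose moreover that one of the following sets of hypotheses (A), (B), (C) holds: (A) $E$ is $\overline{\mathrm O}$-complete; $F$ and $g$ are $(\ast,\overline{\mathrm O})$-compatible; $g$ is $\overline{\mathrm O}$-continuous; either $F$ is $\overline{\mathrm O}$-continuous or $(E,d,\preceq)$ has the $g$-ICU property; and there exist $x^{(0)}_1,\dots,x^{(0)}_n\in X$ with $g(x^{(0)}_i)\preceq F(x^{(0)}_{i_1},\dots,x^{(0)}_{i_n})$ for each $i\in I_n$; (B) $E$ is $\underline{\mathrm O}$-complete; $F$ and $g$ are $(\ast,\underline{\mathrm O})$-compatible; $g$ is $\underline{\mathrm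 O}$-continuous; either $F$ is $\underline{\mathrm O}$-continuous or $(E,d,\preceq)$ has the $g$-DCL property; and there exist $x^{(0)}_1,\dots,x^{(0)}_n\in X$ with $g(x^{(0)}_i)\succeq F(x^{(0)}_{i_1},\dots,x^{(0)}_{i_n})$ for each $i\in I_n$; (C) $E$ is $\mathrm O$-complete; $F$ and $g$ are $(\ast,\mathrm O)$-compatible; $g$ is $\mathrm O$-continuous; either $F$ is $\mathrm O$-continuous or $(E,d,\preceq)$ has the $g$-MCB property; and there exist $x^{(0)}_1,\dots,x^{(0)}_n\in X$ with either $g(x^{(0)}_i)\preceq F(x^{(0)}_{i_1},\dots,x^{(0)}_{i_n})$ for each $i\in I_n$ or $g(x^{(0)}_i)\succeq F(x^{(0)}_{i_1},\dots,x^{(0)}_{i_n})$ for each $i\in I_n$. Suppose finally that for every pair $(x_1,\dots,x_n),(y_1,\dots,y_n)\in X^n$ there exists $(z_1,\dots,z_n)\in X^n$ such that $(gz_1,\dots,gz_n)$ is comparable to both $(gx_1,\dots,gx_n)$ and $(gy_1,\dots,gy_n)$ with respect to the partial order $\sqsubseteq_n$. Then $F$ and $g$ have a unique point of $\ast$-coincidence, which is also a unique common $\ast$-fixed point of $F$ and $g$.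
   Context: Throughout, $n\ge 2$ is a fixed integer, $I_n=\{1,\dots,n\}$, and sequences are indexed by $m\in\mathbb N_0$. An ordered metric space $(X,d,\preceq)$ is a nonempty set $X$ with a metric $d$ and a partial order $\preceq$; $x\succeq y$ means $y\preceq x$. A subspace is a nonempty subset with the restricted metric and order. We write $gx$ for $g(x)$. On $X^n$, $(x_1,\dots,x_n)\sqsubseteq_n(y_1,\dots,y_n)$ iff $x_i\preceq y_i$ for each $i\in I_n$; two elements are comparable if one is $\sqsubseteq_n$ the other. $\mathfrak B_n$ is the set of all binary operations $\ast:I_n\times I_n\to I_n$; for $\ast\in\mathfrak B_n$ write $i_k:=\ast(i,k)$. A sequence $\{x^{(m)}\}$ is increasing (decreasing) if $x^{(m)}\preceq x^{(m+1)}$ (resp. $x^{(m)}\succeq x^{(m+1)}$) for all $m$, and monotone if it is increasing or decreasing. $x^{(m)}\uparrow x$, $x^{(m)}\downarrow x$, $x^{(m)}\uparrow\downarrow x$ mean that $\{x^{(m)}\}$ converges to $x$ in $d$ and is, respectively, increasing, decreasing, monotone. $E$ is $\overline{\mathrm O}$-complete (resp. $\underline{\mathrm O}$-complete, $\mathrm O$-complete) if every increasing (resp. decreasing, monotone) Cauchy sequence in $E$ converges in $E$. $g$ is $\overline{\mathrm O}$-continuous if for every $x\in X$ and every sequence in $X$ with $x^{(m)}\uparrow x$ one has $g(x^{(m)})\to g(x)$. $F$ is $\overline{\mathrm O}$-continuous if for every $(x_1,\dots,x_n)\in X^n$ and all sequences $\{x_1^{(m)}\},\dots,\{x_n^{(m)}\}$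 in $X$ with $x_i^{(m)}\uparrow x_i$ for each $i$, one has $F(x_1^{(m)},\dots,x_n^{(m)})\to F(x_1,\dots,x_n)$. $\underline{\mathrm O}$-continuity and $\mathrm O$-continuity are defined in the same way with $\uparrow$ replaced by $\downarrow$, resp. by $\uparrow\downarrow$. $(E,d,\preceq)$ has the $g$-ICU property if for every sequence $\{x^{(m)}\}$ in $E$ and $x\in E$ with $x^{(m)}\uparrow x$, one has $g(x^{(m)})\preceq g(x)$ for all $m$; the $g$-DCL property if $x^{(m)}\downarrow x$ (in $E$) implies $g(x^{(m)})\succeq g(x)$ for all $m$; the $g$-MCB property if it has both. $F$ has the $g$-monotone property if, for all $x_1,\dots,x_n,y_1,\dots,y_n\in X$, $g(x_i)\preceq g(y_i)$ for all $i\in I_n$ implies $F(x_1,\dots,x_n)\preceq F(y_1,\dots,y_n)$. $F$ and $g$ are $(\ast,\overline{\mathrm O})$-compatible if for any sequences $\{x_1^{(m)}\},\dots,\{x_n^{(m)}\}$ in $X$ and any $z_1,\dots,z_n\in X$ with $g(x_i^{(m)})\uparrow z_i$ and $F(x_{i_1}^{(m)},\dots,x_{i_n}^{(m)})\uparrow z_i$ for each $i\in I_n$, one has $\lim_{m\to\infty}d\big(gF(x_{i_1}^{(m)},\dots,x_{i_n}^{(m)}),F(gx_{i_1}^{(m)},\dots,gx_{i_n}^{(m)})\big)=0$ for each $i\in I_n$. $(\ast,\underline{\mathrm O})$-compatibility and $(\ast,\mathrm O)$-compatibility are defined in the same way with $\uparrow$ replaced by $\downarrow$, resp. by $\uparrow\downarrow$.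 $\Omega$ is the set of functions $\varphi:[0,\infty)\to[0,\infty)$ with $\varphi(t)<t$ and $\limsup_{r\to t^+}\varphi(r)<t$ for each $t>0$. $(x_1,\dots,x_n)\in X^n$ is an $\ast$-coincidence point of $F$ and $g$ if $F(x_{i_1},\dots,x_{i_n})=g(x_i)$ for each $i\in I_n$; then $(gx_1,\dots,gx_n)$ is called a point of $\ast$-coincidence of $F$ and $g$. It is a common $\ast$-fixed point of $F$ and $g$ if $F(x_{i_1},\dots,x_{i_n})=g(x_i)=x_i$ for each $i\in I_n$. *)

theory Defs
  imports "HOL-Analysis.Analysis"
begin

text \<open>
  The ordered metric space \<open>X\<close> is a type of sort \<open>{metric_space, order}\<close> (no relation between metric
  and order is assumed), \<open>E\<close> is a set in it. The index set \<open>I\<^sub>n\<close> is a finite type \<open>'n\<close> with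
  \<open>n = CARD('n)\<close>, tuples in \<open>X\<^sup>n\<close> are elements of \<^typ>\<open>'a ^ 'n\<close>, and a binary operation
  on \<open>I\<^sub>n\<close> is a function \<open>ast :: 'n \<Rightarrow> 'n \<Rightarrow> 'n\<close>, so that \<open>i\<^sub>k = ast i k\<close>. The order on
  \<^typ>\<open>'a ^ 'n\<close> from the library is the componentwise one.

  Each notion with an upper-bar, lower-bar and plain variant takes the kind of sequence as a
  parameter \<open>P\<close>, to be instantiated by \<open>incseq\<close>, \<open>decseq\<close> and \<open>monoseq\<close> respectively. By
  \<open>incseq_Suc_iff\<close>, \<open>decseq_Suc_iff\<close> and \<open>monoseq_Suc\<close> these can be read off consecutive terms.
\<close>

definition lim_via ::
  "((nat \<Rightarrow> 'a) \<Rightarrow> bool) \<Rightarrow> (nat \<Rightarrow> 'a::metric_space) \<Rightarrow> 'a \<Rightarrow> bool"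
  where "lim_via P s x \<longleftrightarrow> P s \<and> s \<longlonglongrightarrow> x"

definition O_complete ::
  "((nat \<Rightarrow> 'a) \<Rightarrow> bool) \<Rightarrow> 'a::metric_space set \<Rightarrow> bool"
  where "O_complete P E \<longleftrightarrow>
    (\<forall>s. range s \<subseteq> E \<and> P s \<and> Cauchy s \<longrightarrow> (\<exists>x\<in>E. s \<longlonglongrightarrow> x))"

definition O_continuous ::
  "((nat \<Rightarrow> 'a) \<Rightarrow> bool) \<Rightarrow> ('a::metric_space \<Rightarrow> 'a) \<Rightarrow> bool"
  where "O_continuous P g \<longleftrightarrow>
    (\<forall>s x. lim_via P s x \<longrightarrow> (\<lambda>m. g (s m)) \<longlonglongrightarrow> g x)"

text \<open>Each coordinate sequence satisfies \<open>P\<close> separately: for \<open>P = monoseq\<close> some coordinates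
  may increase while others decrease.\<close>

definition O_continuous_n ::
  "((nat \<Rightarrow> 'a) \<Rightarrow> bool) \<Rightarrow> ('a::metric_space ^ 'n \<Rightarrow> 'a) \<Rightarrow> bool"
  where "O_continuous_n P F \<longleftrightarrow>
    (\<forall>s x. (\<forall>i. lim_via P (\<lambda>m. s m $ i) (x $ i)) \<longrightarrow> (\<lambda>m. F (s m)) \<longlonglongrightarrow> F x)"

definition ICU_property ::
  "('a \<Rightarrow> 'a) \<Rightarrow> 'a::{metric_space, order} set \<Rightarrow> bool"
  where "ICU_property g E \<longleftrightarrow>
    (\<forall>s x. range s \<subseteq> E \<and> x \<in> E \<and> lim_via incseq s x \<longrightarrow> (\<forall>m. g (s m) \<le> g x))"

definition DCL_property ::
  "('a \<Rightarrow> 'a) \<Rightarrow> 'a::{metric_space, order} set \<Rightarrow> bool"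
  where "DCL_property g E \<longleftrightarrow>
    (\<forall>s x. range s \<subseteq> E \<and> x \<in> E \<and> lim_via decseq s x \<longrightarrow> (\<forall>m. g x \<le> g (s m)))"

definition MCB_property ::
  "('a \<Rightarrow> 'a) \<Rightarrow> 'a::{metric_space, order} set \<Rightarrow> bool"
  where "MCB_property g E \<longleftrightarrow> ICU_property g E \<and> DCL_property g E"

definition g_monotone ::
  "('a::order ^ 'n \<Rightarrow> 'a) \<Rightarrow> ('a \<Rightarrow> 'a) \<Rightarrow> bool"
  where "g_monotone F g \<longleftrightarrow> (\<forall>x y. (\<forall>i. g (x $ i) \<le> g (y $ i)) \<longrightarrow> F x \<le> F y)"

definition reindex :: "('n \<Rightarrow> 'n \<Rightarrow> 'n) \<Rightarrow> 'a ^ 'n \<Rightarrow> 'n \<Rightarrow> 'a ^ 'n"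
  where "reindex ast x i = (\<chi> k. x $ ast i k)"

definition map_tuple :: "('a \<Rightarrow> 'a) \<Rightarrow> 'a ^ 'n \<Rightarrow> 'a ^ 'n"
  where "map_tuple g x = (\<chi> i. g (x $ i))"

definition comparable_n :: "'a::order ^ 'n \<Rightarrow> 'a ^ 'n \<Rightarrow> bool"
  where "comparable_n x y \<longleftrightarrow> x \<le> y \<or> y \<le> x"

definition ast_compatible ::
  "('n \<Rightarrow> 'n \<Rightarrow> 'n) \<Rightarrow> ((nat \<Rightarrow> 'a) \<Rightarrow> bool) \<Rightarrow>
    ('a::metric_space ^ 'n \<Rightarrow> 'a) \<Rightarrow> ('a \<Rightarrow> 'a) \<Rightarrow> bool"
  where "ast_compatible ast P F g \<longleftrightarrow>
    (\<forall>(s :: nat \<Rightarrow> 'a ^ 'n) (z :: 'a ^ 'n).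
      (\<forall>i. lim_via P (\<lambda>m. g (s m $ i)) (z $ i) \<and>
           lim_via P (\<lambda>m. F (reindex ast (s m) i)) (z $ i)) \<longrightarrow>
      (\<forall>i. (\<lambda>m. dist (g (F (reindex ast (s m) i)))
                      (F (map_tuple g (reindex ast (s m) i)))) \<longlonglongrightarrow> 0))"

text \<open>Functions \<open>[0,\<infinity>) \<rightarrow> [0,\<infinity>)\<close> are represented by real functions whose values at negative
  arguments are irrelevant. The limit superior is taken in the extended reals.\<close>

definition Omega :: "(real \<Rightarrow> real) set"
  where "Omega = {\<phi>. (\<forall>t\<ge>0. \<phi> t \<ge> 0) \<and>
    (\<forall>t>0. \<phi> t < t \<and> Limsup (at_right t) (\<lambda>r. ereal (\<phi> r)) < ereal t)}"

definition contractive_mean ::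
  "('n \<Rightarrow> 'n \<Rightarrow> 'n) \<Rightarrow> (real \<Rightarrow> real) \<Rightarrow>
    ('a::{metric_space, order} ^ 'n \<Rightarrow> 'a) \<Rightarrow> ('a \<Rightarrow> 'a) \<Rightarrow> bool"
  where "contractive_mean ast \<phi> F g \<longleftrightarrow>
    (\<forall>x y. (\<forall>i. g (x $ i) \<le> g (y $ i)) \<or> (\<forall>i. g (y $ i) \<le> g (x $ i)) \<longrightarrow>
      1 / real CARD('n) * (\<Sum>i\<in>UNIV. dist (F (reindex ast x i)) (F (reindex ast y i)))
      \<le> \<phi> (1 / real CARD('n) * (\<Sum>i\<in>UNIV. dist (g (x $ i)) (g (y $ i)))))"

definition contractive_max ::
  "('n \<Rightarrow> 'n \<Rightarrow> 'n) \<Rightarrow> (real \<Rightarrow> real) \<Rightarrow>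
    ('a::{metric_space, order} ^ 'n \<Rightarrow> 'a) \<Rightarrow> ('a \<Rightarrow> 'a) \<Rightarrow> bool"
  where "contractive_max ast \<phi> F g \<longleftrightarrow>
    (\<forall>x y. (\<forall>i. g (x $ i) \<le> g (y $ i)) \<or> (\<forall>i. g (y $ i) \<le> g (x $ i)) \<longrightarrow>
      (MAX i. dist (F (reindex ast x i)) (F (reindex ast y i)))
      \<le> \<phi> (MAX i. dist (g (x $ i)) (g (y $ i))))"

definition ast_coincidence_point ::
  "('n \<Rightarrow> 'n \<Rightarrow> 'n) \<Rightarrow> ('a ^ 'n \<Rightarrow> 'a) \<Rightarrow> ('a \<Rightarrow> 'a) \<Rightarrow> 'a ^ 'n \<Rightarrow> bool"
  where "ast_coincidence_point ast F g x \<longleftrightarrow> (\<forall>i. F (reindex ast x i) = g (x $ i))"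

definition point_of_ast_coincidence ::
  "('n \<Rightarrow> 'n \<Rightarrow> 'n) \<Rightarrow> ('a ^ 'n \<Rightarrow> 'a) \<Rightarrow> ('a \<Rightarrow> 'a) \<Rightarrow> 'a ^ 'n \<Rightarrow> bool"
  where "point_of_ast_coincidence ast F g w \<longleftrightarrow>
    (\<exists>x. ast_coincidence_point ast F g x \<and> w = map_tuple g x)"

definition common_ast_fixed_point ::
  "('n \<Rightarrow> 'n \<Rightarrow> 'n) \<Rightarrow> ('a ^ 'n \<Rightarrow> 'a) \<Rightarrow> ('a \<Rightarrow> 'a) \<Rightarrow> 'a ^ 'n \<Rightarrow> bool"
  where "common_ast_fixed_point ast F g x \<longleftrightarrow>
    (\<forall>i. F (reindex ast x i) = g (x $ i) \<and> g (x $ i) = x $ i)"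

end

theory Submission
  imports Defs
begin

text \<open>
  The \<open>n\<close> equations that define an \<open>\<ast>\<close>-coincidence point form a single equation \<open>T x = G x\<close> in
  the product \<open>X\<^sup>n\<close>, where \<open>T = ast_map ast F\<close> evaluates \<open>F\<close> at every reindexing of \<open>x\<close> and
  \<open>G = map_tuple g\<close> applies \<open>g\<close> to each coordinate. Both forms of the contractivity
  condition say that \<open>D (T x) (T y) \<le> \<phi> (D (G x) (G y))\<close>
  for comparable \<open>G x\<close>, \<open>G y\<close>, where \<open>D\<close> is the mean or the maximum of the coordinate distances.
  So the theorem is about a pair of maps on one ordered metric space.

  For \<open>\<phi> \<in> \<Omega>\<close> this contraction implies the Meir--Keeler condition: for every \<open>\<epsilon> > 0\<close> there is
  \<open>\<delta> > 0\<close> such that \<open>D (G x) (G y) < \<epsilon> + \<delta>\<close> forces \<open>D (T x) (T y) < \<epsilon>\<close>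
  whenever \<open>G x\<close> and \<open>G y\<close> are comparable (\<open>Omega_gap\<close>, \<open>meir_keeler_pair_tuples\<close>). Since \<open>\<phi> 0\<close> may be positive, the case \<open>G x = G y\<close>
  comes from monotonicity and antisymmetry, which give \<open>T x = T y\<close>.

  The Meir--Keeler condition drives the iteration \<open>G x\<^sub>m\<^sub>+\<^sub>1 = T x\<^sub>m\<close>. Two iterations whose images under
  \<open>G\<close> start comparable stay comparable and merge (\<open>iterations_merge\<close>). Merging of an
  iteration with its own shift gives vanishing steps, hence the Cauchy property
  (\<open>iteration_Cauchy\<close>). Merging of an iteration with a coincidence point shows that a point
  comparable to two coincidence values leads to both of them, so they agree
  (\<open>coincidence_value_unique\<close>).

  The limit \<open>z\<close> of \<open>G x\<^sub>m\<close> is itself a coincidence point: \<open>G (T x\<^sub>m)\<close> tends to \<open>G z\<close> and \<open>T (G x\<^sub>m)\<close>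
  tends to \<open>T z\<close>, and compatibility makes the distance between them vanish
  (\<open>ast_coincidence_point_exists\<close>). Finally, compatibility along a constant sequence makes \<open>T\<close> and
  \<open>G\<close> commute at a coincidence point \<open>x\<close>, so the value \<open>w = G x\<close> is again a coincidence
  point; its value \<open>G w\<close> must be the unique one, which is \<open>w\<close>. Hence \<open>T w = G w = w\<close>.
\<close>

section \<open>Meir--Keeler pairs of maps\<close>

text \<open>
  The relation \<open>R\<close> is kept abstract so that the componentwise order and its converse are both
  instances, which makes decreasing iterations as good as increasing ones. The contraction is
  measured by \<open>D\<close>, while limits are taken in \<open>dist\<close>; the two bounds allow passing between
  them. The Meir--Keeler condition replaces the function \<open>\<phi>\<close>.
\<close>

locale meir_keeler_pair =
  fixes R :: "'b::metric_space \<Rightarrow> 'b \<Rightarrow> bool"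
    and D :: "'b \<Rightarrow> 'b \<Rightarrow> real"
    and K :: real
    and T G :: "'b \<Rightarrow> 'b"
  assumes R_refl: "R x x"
    and R_trans: "R x y \<Longrightarrow> R y z \<Longrightarrow> R x z"
    and D_commute: "D x y = D y x"
    and D_triangle: "D x z \<le> D x y + D y z"
    and D_le_dist: "D x y \<le> dist x y"
    and dist_le_D: "dist x y \<le> K * D x y"
    and K_pos: "K > 0"
    and range_T: "range T \<subseteq> range G"
    and mono: "R (G x) (G y) \<Longrightarrow> R (T x) (T y)"
    and meir_keeler: "\<epsilon> > 0 \<Longrightarrow>
      \<exists>\<delta>>0. \<forall>x y. R (G x) (G y) \<longrightarrow> D (G x) (G y) < \<epsilon> + \<delta> \<longrightarrow> D (T x) (T y) < \<epsilon>"
begin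

lemma D_nonneg: "0 \<le> D x y"
proof -
  have "0 \<le> K * D x y" using dist_le_D[of x y] zero_le_dist[of x y] by linarith
  then show ?thesis using K_pos by (simp add: zero_le_mult_iff)
qed

text \<open>Apply the Meir--Keeler condition at every level above \<open>D (G x) (G y)\<close>.\<close>

lemma nonexpansive:
  assumes "R (G x) (G y)"
  shows "D (T x) (T y) \<le> D (G x) (G y)"
proof (rule dense_ge)
  fix \<epsilon> assume "D (G x) (G y) < \<epsilon>"
  moreover from this have "\<epsilon> > 0" using D_nonneg[of "G x" "G y"] by linarith
  ultimately show "D (T x) (T y) \<le> \<epsilon>"
    using meir_keeler[of \<epsilon>] assms by fastforce
qed

definition iteration :: "(nat \<Rightarrow> 'b) \<Rightarrow> bool"
  where "iteration x \<longleftrightarrow> (\<forall>m. G (x (Suc m)) = T (x m))"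

lemma iteration_exists: "\<exists>x. x 0 = a \<and> iteration x"
proof -
  have "\<forall>v. \<exists>u. G u = T v" using range_T by (metis rangeE range_subsetD)
  then obtain h where h: "\<And>v. G (h v) = T v" by metis
  show ?thesis
    by (rule exI[of _ "\<lambda>m. (h ^^ m) a"]) (simp add: iteration_def h)
qed

lemma iteration_R:
  assumes "iteration u" "iteration v" "R (G (u 0)) (G (v 0))"
  shows "R (G (u m)) (G (v m))"
proof (induction m)
  case (Suc m)
  then show ?case using mono assms(1,2) by (simp add: iteration_def)
qed (use assms in simp)

text \<open>
  The distances decrease to some \<open>t\<close>. If \<open>t\<close> were positive, the Meir--Keeler condition at level
  \<open>t\<close> would push the distances strictly below their own limit.
\<close>

lemma iterations_merge:
  assumes u: "iteration u" and v: "iteration v" and R0: "R (G (u 0)) (G (v 0))"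
  shows "(\<lambda>m. D (G (u m)) (G (v m))) \<longlonglongrightarrow> 0"
proof -
  define e where "e = (\<lambda>m. D (G (u m)) (G (v m)))"
  have e_Suc: "e (Suc m) = D (T (u m)) (T (v m))" for m
    using u v by (simp add: e_def iteration_def)
  have R: "R (G (u m)) (G (v m))" for m by (rule iteration_R[OF assms])
  have "decseq e"
    using nonexpansive[OF R] by (simp add: decseq_Suc_iff e_Suc) (simp add: e_def)
  moreover have "0 \<le> e m" for m by (simp add: e_def D_nonneg)
  ultimately obtain t where lim: "e \<longlonglongrightarrow> t" and above: "\<And>m. t \<le> e m"
    using decseq_convergent[of e 0] by metis
  have "t \<ge> 0" using lim \<open>\<And>m. 0 \<le> e m\<close> by (simp add: LIMSEQ_le_const)
  moreover have "\<not> t > 0"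
  proof
    assume "t > 0"
    then obtain \<delta> where "\<delta> > 0"
      and \<delta>: "\<And>x y. R (G x) (G y) \<Longrightarrow> D (G x) (G y) < t + \<delta> \<Longrightarrow> D (T x) (T y) < t"
      using meir_keeler by meson
    then have "eventually (\<lambda>m. e m < t + \<delta>) sequentially"
      using lim by (intro order_tendstoD) auto
    then obtain m where "e m < t + \<delta>" by (meson eventually_sequentially order_refl)
    then have "e (Suc m) < t" using \<delta>[OF R] by (simp add: e_Suc) (simp add: e_def)
    then show False using above[of "Suc m"] by simp
  qed
  ultimately show ?thesis using lim by (simp add: e_def)
qed

lemma dist_tendsto_zero:
  assumes "(\<lambda>m. D (u m) (v m)) \<longlonglongrightarrow> 0"
  shows "(\<lambda>m. dist (u m) (v m)) \<longlonglongrightarrow> 0"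
proof (rule Lim_null_comparison)
  show "(\<lambda>m. K * D (u m) (v m)) \<longlonglongrightarrow> 0" using tendsto_mult_right_zero[OF assms] by simp
qed (use dist_le_D in auto)

lemma iteration_chain:
  assumes x: "iteration x" and R0: "R (G (x 0)) (T (x 0))"
  shows "R (G (x m)) (G (x (m + k)))"
proof (induction k)
  case (Suc k)
  have "iteration (\<lambda>m. x (Suc m))" using x by (simp add: iteration_def)
  moreover have "R (G (x 0)) (G (x (Suc 0)))" using x R0 by (simp add: iteration_def)
  ultimately have "R (G (x (m + k))) (G (x (Suc (m + k))))" using x iteration_R by metis
  then show ?case using Suc R_trans by auto
qed (simp add: R_refl)

text \<open>
  Choose \<open>\<delta>\<close> for \<open>\<epsilon>\<close> and start where consecutive terms are closer than \<open>\<delta>\<close>. The ball of radius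
  \<open>\<epsilon> + \<delta>\<close> around a term then traps all later ones: by the Meir--Keeler condition the next
  distance is below \<open>\<epsilon>\<close> when measured from the shifted centre, and moving the centre back costs
  less than \<open>\<delta>\<close>.
\<close>

lemma iteration_Cauchy:
  assumes x: "iteration x" and R0: "R (G (x 0)) (T (x 0))"
  shows "Cauchy (\<lambda>m. G (x m))"
proof (rule metric_CauchyI)
  fix \<eta> :: real assume "\<eta> > 0"
  (* The trapping radius is at most 2 * \<epsilon>, and passing from D to dist costs the factor K. *)
  define \<epsilon> where "\<epsilon> = \<eta> / (2 * K)"
  have "\<epsilon> > 0" using \<open>\<eta> > 0\<close> K_pos by (simp add: \<epsilon>_def)
  then obtain \<delta>0 where "\<delta>0 > 0"
    and \<delta>0: "\<And>x y. R (G x) (G y) \<Longrightarrow> D (G x) (G y) < \<epsilon> + \<delta>0 \<Longrightarrow> D (T x) (T y) < \<epsilon>"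
    using meir_keeler by meson
  define \<delta> where "\<delta> = min \<delta>0 \<epsilon>"
  have "\<delta> > 0" "\<delta> \<le> \<epsilon>" using \<open>\<delta>0 > 0\<close> \<open>\<epsilon> > 0\<close> by (auto simp: \<delta>_def)
  have \<delta>: "D (T x) (T y) < \<epsilon>" if "R (G x) (G y)" "D (G x) (G y) < \<epsilon> + \<delta>" for x y
    using \<delta>0 that by (simp add: \<delta>_def)
  have "iteration (\<lambda>m. x (Suc m))" "R (G (x 0)) (G (x (Suc 0)))"
    using x R0 by (simp_all add: iteration_def)
  then have "(\<lambda>m. D (G (x m)) (G (x (Suc m)))) \<longlonglongrightarrow> 0"
    using iterations_merge[OF x] by simp
  then have "eventually (\<lambda>m. D (G (x m)) (G (x (Suc m))) < \<delta>) sequentially"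
    using \<open>\<delta> > 0\<close> by (intro order_tendstoD) auto
  then obtain N where N: "\<And>m. m \<ge> N \<Longrightarrow> D (G (x m)) (G (x (Suc m))) < \<delta>"
    by (auto simp: eventually_sequentially)
  have near: "D (G (x m)) (G (x (m + k))) < \<epsilon> + \<delta>" if "m \<ge> N" for m k
  proof (induction k)
    case 0
    then show ?case using D_le_dist[of "G (x m)" "G (x m)"] \<open>\<epsilon> > 0\<close> \<open>\<delta> > 0\<close> by simp
  next
    case (Suc k)
    have "D (T (x m)) (T (x (m + k))) < \<epsilon>"
      by (rule \<delta>[OF iteration_chain[OF x R0] Suc])
    then have "D (G (x (Suc m))) (G (x (m + Suc k))) < \<epsilon>"
      using x by (simp add: iteration_def)
    then show ?case
      using D_triangle[of "G (x m)" "G (x (m + Suc k))" "G (x (Suc m))"] N[OF that] by linarith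
  qed
  have close: "dist (G (x m)) (G (x n)) < \<eta>" if "m \<ge> N" "m \<le> n" for m n
  proof -
    have "D (G (x m)) (G (x n)) < 2 * \<epsilon>"
      using near[OF that(1), of "n - m"] that(2) \<open>\<delta> \<le> \<epsilon>\<close> by simp
    then have "K * D (G (x m)) (G (x n)) < K * (2 * \<epsilon>)" using K_pos by simp
    then show ?thesis using dist_le_D[of "G (x m)" "G (x n)"] K_pos by (simp add: \<epsilon>_def)
  qed
  show "\<exists>N. \<forall>m\<ge>N. \<forall>n\<ge>N. dist (G (x m)) (G (x n)) < \<eta>"
    by (metis close dist_commute nle_le)
qed

text \<open>A coincidence point is a constant iteration, so iterations comparable to it merge with it.\<close>

lemma iteration_tendsto_coincidence:
  assumes z: "iteration z" and p: "T p = G p"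
    and comp: "R (G (z 0)) (G p) \<or> R (G p) (G (z 0))"
  shows "(\<lambda>m. G (z m)) \<longlonglongrightarrow> G p"
proof -
  have const: "iteration (\<lambda>m. p)" using p by (simp add: iteration_def)
  have "(\<lambda>m. D (G (z m)) (G p)) \<longlonglongrightarrow> 0"
    using comp iterations_merge[OF z const] iterations_merge[OF const z]
    by (auto simp: D_commute[of "G p"])
  then show ?thesis by (rule tendsto_dist_iff[THEN iffD2, OF dist_tendsto_zero])
qed

lemma coincidence_value_unique:
  assumes p: "T p = G p" and q: "T q = G q"
    and "R (G a) (G p) \<or> R (G p) (G a)" "R (G a) (G q) \<or> R (G q) (G a)"
  shows "G p = G q"
proof -
  obtain z where "z 0 = a" "iteration z" using iteration_exists by blast
  then show ?thesis
    using iteration_tendsto_coincidence[of z] assms LIMSEQ_unique by metis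
qed

text \<open>
  A one-sided bound by \<open>G p\<close> can thus replace continuity of \<open>T\<close>; this is the use of the ICU and
  DCL properties.
\<close>

lemma T_tendsto:
  assumes R: "\<And>m. R (G (s m)) (G p)" and lim: "(\<lambda>m. G (s m)) \<longlonglongrightarrow> G p"
  shows "(\<lambda>m. T (s m)) \<longlonglongrightarrow> T p"
proof -
  have "(\<lambda>m. D (T (s m)) (T p)) \<longlonglongrightarrow> 0"
  proof (rule Lim_null_comparison)
    show "(\<lambda>m. dist (G (s m)) (G p)) \<longlonglongrightarrow> 0" using lim by (rule tendsto_dist_iff[THEN iffD1])
    show "\<forall>\<^sub>F m in sequentially. norm (D (T (s m)) (T p)) \<le> dist (G (s m)) (G p)"
      using order_trans[OF nonexpansive[OF R] D_le_dist] by (simp add: D_nonneg)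
  qed
  then show ?thesis by (rule tendsto_dist_iff[THEN iffD2, OF dist_tendsto_zero])
qed

end

section \<open>Functions in \<open>\<Omega>\<close>\<close>

text \<open>
  To the right of \<open>t\<close> the bound is what the limit superior says; at \<open>t\<close> and to its left it follows
  from \<open>\<phi> r < r\<close>. The point \<open>r = 0\<close> is excluded because \<open>\<phi> 0\<close> can be any
  nonnegative number.
\<close>

lemma Omega_gap:
  assumes "\<phi> \<in> Omega" "t > 0"
  shows "\<exists>\<delta>>0. \<forall>r>0. r < t + \<delta> \<longrightarrow> \<phi> r < t"
proof -
  have less: "\<phi> r < r" if "r > 0" for r using assms(1) that by (simp add: Omega_def)
  have "Limsup (at_right t) (\<lambda>r. ereal (\<phi> r)) < ereal t"
    using assms by (simp add: Omega_def)
  then have "\<forall>\<^sub>F r in at_right t. ereal (\<phi> r) < ereal t" by (rule Limsup_lessD)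
  then obtain b where b: "b > t" "\<And>r. t < r \<Longrightarrow> r < b \<Longrightarrow> \<phi> r < t"
    by (auto simp: eventually_at_right_field)
  have "\<phi> r < t" if "r > 0" "r < t + (b - t)" for r
  proof (cases "r \<le> t")
    case True
    then show ?thesis using less[OF that(1)] by linarith
  qed (use b that in simp)
  then show ?thesis using b(1) by (metis diff_gt_0_iff_gt)
qed

section \<open>The maps on tuples\<close>

definition ast_map :: "('n \<Rightarrow> 'n \<Rightarrow> 'n) \<Rightarrow> ('a ^ 'n \<Rightarrow> 'a) \<Rightarrow> 'a ^ 'n \<Rightarrow> 'a ^ 'n"
  where "ast_map ast F x = (\<chi> i. F (reindex ast x i))"

definition coordwise :: "('a \<Rightarrow> 'a \<Rightarrow> bool) \<Rightarrow> 'a ^ 'n \<Rightarrow> 'a ^ 'n \<Rightarrow> bool"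
  where "coordwise r x y \<longleftrightarrow> (\<forall>i. r (x $ i) (y $ i))"

lemma ast_map_nth [simp]: "ast_map ast F x $ i = F (reindex ast x i)"
  by (simp add: ast_map_def)

lemma map_tuple_nth [simp]: "map_tuple g x $ i = g (x $ i)"
  by (simp add: map_tuple_def)

lemma ast_coincidence_point_iff:
  "ast_coincidence_point ast F g x \<longleftrightarrow> ast_map ast F x = map_tuple g x"
  by (simp add: ast_coincidence_point_def vec_eq_iff)

lemma map_tuple_reindex: "map_tuple g (reindex ast x i) = reindex ast (map_tuple g x) i"
  by (simp add: map_tuple_def reindex_def)

definition mean_dist :: "'a::metric_space ^ 'n \<Rightarrow> 'a ^ 'n \<Rightarrow> real"
  where "mean_dist x y = 1 / real CARD('n) * (\<Sum>i\<in>UNIV. dist (x $ i) (y $ i))"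

definition max_dist :: "'a::metric_space ^ 'n::finite \<Rightarrow> 'a ^ 'n \<Rightarrow> real"
  where "max_dist x y = (MAX i. dist (x $ i) (y $ i))"

lemma dist_vec_le_sum:
  fixes x y :: "'a::metric_space ^ 'n::finite"
  shows "dist x y \<le> (\<Sum>i\<in>UNIV. dist (x $ i) (y $ i))"
  by (simp add: dist_vec_def L2_set_le_sum)

lemma dist_nth_le_max_dist:
  fixes x y :: "'a::metric_space ^ 'n::finite"
  shows "dist (x $ i) (y $ i) \<le> max_dist x y"
  by (simp add: max_dist_def)

lemma max_dist_le:
  fixes x y :: "'a::metric_space ^ 'n::finite"
  assumes "\<And>i. dist (x $ i) (y $ i) \<le> c"
  shows "max_dist x y \<le> c"
  using assms by (auto simp: max_dist_def)

text \<open>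
  The properties shared by the mean and the maximum metric: both lie below the Euclidean
  combination that is the library metric on tuples, which is in turn at most \<open>n\<close> times either.
\<close>

definition tuple_metric :: "('a::metric_space ^ 'n::finite \<Rightarrow> 'a ^ 'n \<Rightarrow> real) \<Rightarrow> bool"
  where "tuple_metric D \<longleftrightarrow>
    (\<forall>x y. D x y = D y x) \<and> (\<forall>x y z. D x z \<le> D x y + D y z) \<and>
    (\<forall>x y. D x y \<le> dist x y) \<and> (\<forall>x y. dist x y \<le> real CARD('n) * D x y)"

lemma tuple_metric_mean_dist:
  "tuple_metric (mean_dist :: 'a::metric_space ^ 'n::finite \<Rightarrow> 'a ^ 'n \<Rightarrow> real)"
  unfolding tuple_metric_def
proof (intro conjI allI)
  fix x y z :: "'a ^ 'n"
  show "mean_dist x y = mean_dist y x" by (simp add: mean_dist_def dist_commute)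
  have "(\<Sum>i\<in>UNIV. dist (x $ i) (z $ i))
      \<le> (\<Sum>i\<in>UNIV. dist (x $ i) (y $ i)) + (\<Sum>i\<in>UNIV. dist (y $ i) (z $ i))"
    unfolding sum.distrib[symmetric] by (intro sum_mono dist_triangle)
  then show "mean_dist x z \<le> mean_dist x y + mean_dist y z"
    by (simp add: mean_dist_def add_divide_distrib[symmetric] divide_right_mono)
  have "(\<Sum>i\<in>UNIV. dist (x $ i) (y $ i)) \<le> real CARD('n) * dist x y"
    by (rule sum_bounded_above) (simp add: dist_vec_nth_le)
  then show "mean_dist x y \<le> dist x y"
    by (simp add: mean_dist_def field_simps)
  show "dist x y \<le> real CARD('n) * mean_dist x y"
    using dist_vec_le_sum[of x y] by (simp add: mean_dist_def)
qed

lemma tuple_metric_max_dist: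
  "tuple_metric (max_dist :: 'a::metric_space ^ 'n::finite \<Rightarrow> 'a ^ 'n \<Rightarrow> real)"
  unfolding tuple_metric_def
proof (intro conjI allI)
  fix x y z :: "'a ^ 'n"
  show "max_dist x y = max_dist y x" by (simp add: max_dist_def dist_commute)
  show "max_dist x z \<le> max_dist x y + max_dist y z"
    by (rule max_dist_le, rule order_trans[OF dist_triangle add_mono])
      (rule dist_nth_le_max_dist)+
  show "max_dist x y \<le> dist x y"
    by (intro max_dist_le dist_vec_nth_le)
  have "(\<Sum>i\<in>UNIV. dist (x $ i) (y $ i)) \<le> real CARD('n) * max_dist x y"
    by (rule sum_bounded_above) (simp add: dist_nth_le_max_dist)
  then show "dist x y \<le> real CARD('n) * max_dist x y"
    using dist_vec_le_sum[of x y] by linarith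
qed

text \<open>
  The Meir--Keeler condition follows from \<open>Omega_gap\<close> when \<open>G x\<close> and \<open>G y\<close> differ. When they agree,
  \<open>\<phi>\<close> gives nothing useful, but monotonicity in both directions and antisymmetry yield
  \<open>T x = T y\<close>.
\<close>

lemma meir_keeler_pair_tuples:
  fixes F :: "'a::metric_space ^ 'n::finite \<Rightarrow> 'a"
  assumes r: "\<And>x. r x x" "\<And>x y z. r x y \<Longrightarrow> r y z \<Longrightarrow> r x z" "\<And>x y. r x y \<Longrightarrow> r y x \<Longrightarrow> x = y"
    and D: "tuple_metric D" and \<phi>: "\<phi> \<in> Omega"
    and range_F: "range F \<subseteq> range g"
    and mono_F: "\<And>x y. (\<And>i. r (g (x $ i)) (g (y $ i))) \<Longrightarrow> r (F x) (F y)"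
    and contr: "\<And>x y. (\<And>i. r (g (x $ i)) (g (y $ i))) \<Longrightarrow>
      D (ast_map ast F x) (ast_map ast F y) \<le> \<phi> (D (map_tuple g x) (map_tuple g y))"
  shows "meir_keeler_pair (coordwise r) D (real CARD('n)) (ast_map ast F) (map_tuple g)"
proof
  fix x y z :: "'a ^ 'n"
  show "coordwise r x x" using r by (simp add: coordwise_def)
  show "coordwise r x z" if "coordwise r x y" "coordwise r y z"
    using r that unfolding coordwise_def by metis
  show "D x y = D y x" "D x z \<le> D x y + D y z" "D x y \<le> dist x y" "dist x y \<le> real CARD('n) * D x y"
    using D by (auto simp: tuple_metric_def)
  show "real CARD('n) > 0" by simp
  show mono: "coordwise r (ast_map ast F x) (ast_map ast F y)"
    if "coordwise r (map_tuple g x) (map_tuple g y)" for x y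
    using that by (auto simp: coordwise_def reindex_def intro!: mono_F)
  show "range (ast_map ast F) \<subseteq> range (map_tuple g)"
  proof clarify
    fix x
    have "\<forall>i. \<exists>u. F (reindex ast x i) = g u" using range_F by blast
    then obtain u where "\<And>i. F (reindex ast x i) = g (u i)" by metis
    then have "ast_map ast F x = map_tuple g (\<chi> i. u i)" by (simp add: vec_eq_iff)
    then show "ast_map ast F x \<in> range (map_tuple g)" by blast
  qed
  fix \<epsilon> :: real assume "\<epsilon> > 0"
  then obtain \<delta> where "\<delta> > 0" and \<delta>: "\<And>t. t > 0 \<Longrightarrow> t < \<epsilon> + \<delta> \<Longrightarrow> \<phi> t < \<epsilon>"
    using Omega_gap[OF \<phi>] by meson
  have dist0: "dist u v \<le> 0" if "D u v \<le> 0" for u v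
  proof -
    have "dist u v \<le> real CARD('n) * D u v" using D by (simp add: tuple_metric_def)
    also have "\<dots> \<le> 0" using that by (simp add: mult_nonneg_nonpos)
    finally show ?thesis .
  qed
  have "D (ast_map ast F x) (ast_map ast F y) < \<epsilon>"
    if R: "coordwise r (map_tuple g x) (map_tuple g y)"
      and near: "D (map_tuple g x) (map_tuple g y) < \<epsilon> + \<delta>" for x y
  proof (cases "D (map_tuple g x) (map_tuple g y) > 0")
    case True
    have "D (ast_map ast F x) (ast_map ast F y) \<le> \<phi> (D (map_tuple g x) (map_tuple g y))"
      using R by (intro contr) (simp add: coordwise_def)
    also have "\<dots> < \<epsilon>" using True near by (rule \<delta>)
    finally show ?thesis .
  next
    case False
    then have "map_tuple g x = map_tuple g y" using dist0 by (simp add: not_less)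
    then have "coordwise r (map_tuple g y) (map_tuple g x)" using R by simp
    then have "ast_map ast F x = ast_map ast F y"
      using mono[OF R] mono[of y x] r(3) by (auto simp: coordwise_def vec_eq_iff)
    moreover have "D u u \<le> 0" for u using D unfolding tuple_metric_def by (metis dist_self)
    ultimately show ?thesis using \<open>\<epsilon> > 0\<close> by (metis le_less_trans)
  qed
  then show "\<exists>\<delta>>0. \<forall>x y. coordwise r (map_tuple g x) (map_tuple g y) \<longrightarrow>
      D (map_tuple g x) (map_tuple g y) < \<epsilon> + \<delta> \<longrightarrow> D (ast_map ast F x) (ast_map ast F y) < \<epsilon>"
    using \<open>\<delta> > 0\<close> by blast
qed

section \<open>Existence of coincidence points\<close>

text \<open>
  The kind \<open>P\<close> of the sequences and the relation \<open>r\<close> that they follow are separate parameters: in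
  the monotone case \<open>P\<close> is \<open>monoseq\<close> and \<open>r\<close> is either order, depending on the starting point.
  The iteration converges by completeness, and its limit is a coincidence point because
  \<open>G (T x\<^sub>m)\<close> and \<open>T (G x\<^sub>m)\<close> tend to \<open>G z\<close> and \<open>T z\<close> while compatibility brings them together.
\<close>

lemma ast_coincidence_point_exists:
  fixes F :: "'a::metric_space ^ 'n::finite \<Rightarrow> 'a"
  assumes mk: "meir_keeler_pair (coordwise r) D K (ast_map ast F) (map_tuple g)"
    and chain_P: "\<And>s. (\<And>m. r (s m) (s (Suc m))) \<Longrightarrow> P s"
    and range_E: "range F \<subseteq> E"
    and complete: "O_complete P E"
    and compat: "ast_compatible ast P F g"
    and cont_g: "O_continuous P g"
    and F_or_bound: "O_continuous_n P F \<or>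
      (\<forall>s x. range s \<subseteq> E \<and> x \<in> E \<and> (\<forall>m. r (s m) (s (Suc m))) \<and> s \<longlonglongrightarrow> x \<longrightarrow>
        (\<forall>m. r (g (s m)) (g x)))"
    and start: "\<And>i. r (g (x0 $ i)) (F (reindex ast x0 i))"
  shows "\<exists>x. ast_coincidence_point ast F g x"
proof -
  interpret meir_keeler_pair "coordwise r" D K "ast_map ast F" "map_tuple g" by (rule mk)
  obtain x where "x 0 = x0" and x: "iteration x" using iteration_exists by blast
  then have R0: "coordwise r (map_tuple g (x 0)) (ast_map ast F (x 0))"
    using start by (simp add: coordwise_def)
  have step: "F (reindex ast (x m) i) = g (x (Suc m) $ i)" for m i
    using x by (simp add: iteration_def vec_eq_iff)
  (* The shift by one matters: G (x 0) need not lie in E, but later terms are values of T. *)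
  define y where "y = (\<lambda>m. map_tuple g (x (Suc m)))"
  have y_E: "range (\<lambda>m. y m $ i) \<subseteq> E" for i
    using range_E by (auto simp: y_def step[symmetric])
  have y_chain: "r (y m $ i) (y (Suc m) $ i)" for m i
    using iteration_chain[OF x R0, of "Suc m" 1] by (simp add: coordwise_def y_def)
  have "Cauchy y"
    using Cauchy_subseq_Cauchy[OF iteration_Cauchy[OF x R0], of Suc]
    by (simp add: y_def comp_def strict_mono_Suc_iff)
  then have "Cauchy (\<lambda>m. y m $ i)" for i
    by (rule Cauchy_vec_nth)
  moreover have "P (\<lambda>m. y m $ i)" for i by (rule chain_P) (rule y_chain)
  ultimately have "\<exists>c\<in>E. (\<lambda>m. y m $ i) \<longlonglongrightarrow> c" for i
    using complete[unfolded O_complete_def, rule_format, of "\<lambda>m. y m $ i"] y_E by simp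
  then obtain c where c: "\<And>i. c i \<in> E" "\<And>i. (\<lambda>m. y m $ i) \<longlonglongrightarrow> c i" by metis
  define z :: "'a ^ 'n" where "z = (\<chi> i. c i)"
  have z_E: "z $ i \<in> E" and y_lim: "(\<lambda>m. y m $ i) \<longlonglongrightarrow> z $ i" for i
    using c by (simp_all add: z_def)
  have via: "lim_via P (\<lambda>m. y m $ i) (z $ i)" for i
    using y_lim chain_P y_chain by (simp add: lim_via_def)
  have via_Suc: "lim_via P (\<lambda>m. y (Suc m) $ i) (z $ i)" for i
    using LIMSEQ_Suc[OF y_lim] chain_P y_chain by (simp add: lim_via_def)
  have y_eq: "y m $ i = g (x (Suc m) $ i)" "y (Suc m) $ i = F (reindex ast (x (Suc m)) i)" for m i
    by (simp_all add: y_def step)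
  have compat_lim: "(\<lambda>m. dist (g (y (Suc m) $ i)) (ast_map ast F (y m) $ i)) \<longlonglongrightarrow> 0" for i
  proof -
    have "\<forall>i. lim_via P (\<lambda>m. g (x (Suc m) $ i)) (z $ i) \<and>
        lim_via P (\<lambda>m. F (reindex ast (x (Suc m)) i)) (z $ i)"
      using via via_Suc by (simp add: y_eq[symmetric])
    then show ?thesis
      using compat[unfolded ast_compatible_def, rule_format, of "\<lambda>m. x (Suc m)" z i]
      by (simp add: y_def step map_tuple_reindex)
  qed
  have gy_lim: "(\<lambda>m. g (y m $ i)) \<longlonglongrightarrow> g (z $ i)" for i
    using cont_g via by (simp add: O_continuous_def)
  have Ty_lim: "(\<lambda>m. ast_map ast F (y m) $ i) \<longlonglongrightarrow> ast_map ast F z $ i" for i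
    using F_or_bound
  proof
    assume "O_continuous_n P F"
    moreover have "\<forall>k. lim_via P (\<lambda>m. reindex ast (y m) i $ k) (reindex ast z i $ k)"
      using via by (simp add: reindex_def)
    ultimately show ?thesis by (simp add: O_continuous_n_def)
  next
    assume bound: "\<forall>s x. range s \<subseteq> E \<and> x \<in> E \<and> (\<forall>m. r (s m) (s (Suc m))) \<and> s \<longlonglongrightarrow> x \<longrightarrow>
        (\<forall>m. r (g (s m)) (g x))"
    have "r (g (y m $ i)) (g (z $ i))" for m i
      using bound[rule_format, of "\<lambda>m. y m $ i" "z $ i" m] y_E z_E y_chain y_lim by blast
    then have "coordwise r (map_tuple g (y m)) (map_tuple g z)" for m
      by (simp add: coordwise_def)
    moreover have "(\<lambda>m. map_tuple g (y m)) \<longlonglongrightarrow> map_tuple g z"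
      using gy_lim by (intro vec_tendstoI) simp
    ultimately show ?thesis by (intro tendsto_vec_nth T_tendsto)
  qed
  have "F (reindex ast z i) = g (z $ i)" for i
  proof -
    have "dist (g (z $ i)) (ast_map ast F z $ i) = 0"
      using LIMSEQ_unique[OF tendsto_dist[OF LIMSEQ_Suc[OF gy_lim] Ty_lim] compat_lim] .
    then show ?thesis by simp
  qed
  then show ?thesis by (auto simp: ast_coincidence_point_def)
qed

text \<open>
  A constant sequence at \<open>x\<close> meets the premises of compatibility with limit \<open>G x\<close>. The distance
  between \<open>G (T x)\<close> and \<open>T (G x)\<close> is then constant and tends to \<open>0\<close>; since \<open>T x = G x\<close>, this
  is the coincidence equation at \<open>G x\<close>.
\<close>

lemma coincidence_value_is_coincidence_point:
  fixes F :: "'a::metric_space ^ 'n::finite \<Rightarrow> 'a"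
  assumes compat: "ast_compatible ast P F g" and P_const: "\<And>c. P (\<lambda>_. c)"
    and x: "ast_coincidence_point ast F g x"
  shows "ast_coincidence_point ast F g (map_tuple g x)"
proof -
  have "\<forall>i. lim_via P (\<lambda>_. g (x $ i)) (map_tuple g x $ i) \<and>
      lim_via P (\<lambda>_. F (reindex ast x i)) (map_tuple g x $ i)"
    using x P_const by (simp add: lim_via_def ast_coincidence_point_def)
  then have "g (F (reindex ast x i)) = F (map_tuple g (reindex ast x i))" for i
    using compat[unfolded ast_compatible_def, rule_format, of "\<lambda>_. x" "map_tuple g x" i]
    by (simp add: LIMSEQ_const_iff)
  then show ?thesis
    using x by (simp add: ast_coincidence_point_def map_tuple_reindex)
qed

theorem theorem4:
  fixes E :: "'a::{metric_space, order} set"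
    and ast :: "'n::finite \<Rightarrow> 'n \<Rightarrow> 'n"
    and F :: "'a ^ 'n \<Rightarrow> 'a"
    and g :: "'a \<Rightarrow> 'a"
  assumes n_ge_2: "CARD('n) \<ge> 2"
    and E_nonempty: "E \<noteq> {}"
    and range_F: "range F \<subseteq> range g \<inter> E"
    and mono_F: "g_monotone F g"
    and contractive: "\<exists>\<phi>\<in>Omega. contractive_mean ast \<phi> F g \<or> contractive_max ast \<phi> F g"
    and ABC:
      "(O_complete incseq E \<and> ast_compatible ast incseq F g \<and> O_continuous incseq g \<and>
         (O_continuous_n incseq F \<or> ICU_property g E) \<and>
         (\<exists>x0 :: 'a ^ 'n. \<forall>i. g (x0 $ i) \<le> F (reindex ast x0 i)))
       \<or> (O_complete decseq E \<and> ast_compatible ast decseq F g \<and> O_continuous decseq g \<and>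
         (O_continuous_n decseq F \<or> DCL_property g E) \<and>
         (\<exists>x0 :: 'a ^ 'n. \<forall>i. F (reindex ast x0 i) \<le> g (x0 $ i)))
       \<or> (O_complete monoseq E \<and> ast_compatible ast monoseq F g \<and> O_continuous monoseq g \<and>
         (O_continuous_n monoseq F \<or> MCB_property g E) \<and>
         (\<exists>x0 :: 'a ^ 'n. (\<forall>i. g (x0 $ i) \<le> F (reindex ast x0 i)) \<or>
                          (\<forall>i. F (reindex ast x0 i) \<le> g (x0 $ i))))"
    and comparable: "\<forall>x y :: 'a ^ 'n. \<exists>z :: 'a ^ 'n.
      comparable_n (map_tuple g z) (map_tuple g x) \<and> comparable_n (map_tuple g z) (map_tuple g y)"
  shows "\<exists>w. point_of_ast_coincidence ast F g w \<and>
             (\<forall>w'. point_of_ast_coincidence ast F g w' \<longrightarrow> w' = w) \<and>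
             common_ast_fixed_point ast F g w \<and>
             (\<forall>w'. common_ast_fixed_point ast F g w' \<longrightarrow> w' = w)"
proof -
  obtain \<phi> D where \<phi>: "\<phi> \<in> Omega" and D: "tuple_metric D"
    and contr: "\<And>x y. (\<forall>i. g (x $ i) \<le> g (y $ i)) \<or> (\<forall>i. g (y $ i) \<le> g (x $ i)) \<Longrightarrow>
      D (ast_map ast F x) (ast_map ast F y) \<le> \<phi> (D (map_tuple g x) (map_tuple g y))"
  proof -
    from contractive obtain \<phi> where \<phi>: "\<phi> \<in> Omega"
      and "contractive_mean ast \<phi> F g \<or> contractive_max ast \<phi> F g" by blast
    from this(2) show thesis
    proof
      assume "contractive_mean ast \<phi> F g"
      then show thesis
        by (intro that[OF \<phi> tuple_metric_mean_dist])
          (simp only: contractive_mean_def mean_dist_def ast_map_nth map_tuple_nth)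
    next
      assume "contractive_max ast \<phi> F g"
      then show thesis
        by (intro that[OF \<phi> tuple_metric_max_dist])
          (simp only: contractive_max_def max_dist_def ast_map_nth map_tuple_nth)
    qed
  qed
  have ranges: "range F \<subseteq> range g" "range F \<subseteq> E" using range_F by auto
  have up: "meir_keeler_pair (coordwise (\<le>)) D (real CARD('n)) (ast_map ast F) (map_tuple g)"
    by (rule meir_keeler_pair_tuples[OF _ _ _ D \<phi> ranges(1)])
      (use mono_F contr in \<open>auto simp: g_monotone_def\<close>)
  have down: "meir_keeler_pair (coordwise (\<ge>)) D (real CARD('n)) (ast_map ast F) (map_tuple g)"
    by (rule meir_keeler_pair_tuples[OF _ _ _ D \<phi> ranges(1)])
      (use mono_F contr in \<open>auto simp: g_monotone_def\<close>)
  have exists_up: "\<exists>x. ast_coincidence_point ast F g x"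
    if "\<And>s. (\<And>m. s m \<le> s (Suc m)) \<Longrightarrow> P s" "O_complete P E"
      "ast_compatible ast P F g" "O_continuous P g" "O_continuous_n P F \<or> ICU_property g E"
      and x0: "\<exists>x0 :: 'a ^ 'n. \<forall>i. g (x0 $ i) \<le> F (reindex ast x0 i)" for P
  proof -
    from x0 obtain x0 :: "'a ^ 'n" where "\<And>i. g (x0 $ i) \<le> F (reindex ast x0 i)" by blast
    then show ?thesis
      using that(5)
      by (intro ast_coincidence_point_exists[OF up that(1) ranges(2) that(2-4)])
        (auto simp: ICU_property_def lim_via_def incseq_Suc_iff)
  qed
  have exists_down: "\<exists>x. ast_coincidence_point ast F g x"
    if "\<And>s. (\<And>m. s (Suc m) \<le> s m) \<Longrightarrow> P s" "O_complete P E"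
      "ast_compatible ast P F g" "O_continuous P g" "O_continuous_n P F \<or> DCL_property g E"
      and x0: "\<exists>x0 :: 'a ^ 'n. \<forall>i. F (reindex ast x0 i) \<le> g (x0 $ i)" for P
  proof -
    from x0 obtain x0 :: "'a ^ 'n" where "\<And>i. F (reindex ast x0 i) \<le> g (x0 $ i)" by blast
    then show ?thesis
      using that(5)
      by (intro ast_coincidence_point_exists[OF down that(1) ranges(2) that(2-4)])
        (auto simp: DCL_property_def lim_via_def decseq_Suc_iff)
  qed
  from ABC have "\<exists>x. ast_coincidence_point ast F g x"
  proof (elim disjE, goal_cases)
    case 1
    then show ?case by (intro exists_up[of incseq]) (auto simp: incseq_Suc_iff)
  next
    case 2
    then show ?case by (intro exists_down[of decseq]) (auto simp: decseq_Suc_iff)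
  next
    case 3
    then show ?case
      using exists_up[of monoseq] exists_down[of monoseq]
      by (auto simp: monoseq_Suc MCB_property_def)
  qed
  then obtain x where x: "ast_coincidence_point ast F g x" by blast
  have unique: "map_tuple g u = map_tuple g v"
    if "ast_coincidence_point ast F g u" "ast_coincidence_point ast F g v" for u v
  proof -
    obtain z where "comparable_n (map_tuple g z) (map_tuple g u)"
      "comparable_n (map_tuple g z) (map_tuple g v)" using comparable by blast
    then show ?thesis
      using meir_keeler_pair.coincidence_value_unique[OF up, of u v z] that
      by (simp add: ast_coincidence_point_iff comparable_n_def coordwise_def less_eq_vec_def)
  qed
  define w where "w = map_tuple g x"
  obtain P where compat: "ast_compatible ast P F g" and const: "\<And>c :: 'a. P (\<lambda>_. c)"
    using ABC by (auto simp: incseq_def decseq_def monoseq_def)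
  have w: "ast_coincidence_point ast F g w"
    unfolding w_def by (rule coincidence_value_is_coincidence_point[OF compat _ x]) (rule const)
  then have gw: "map_tuple g w = w" using unique[OF w x] by (simp add: w_def)
  have "point_of_ast_coincidence ast F g w"
    using x by (auto simp: point_of_ast_coincidence_def w_def)
  moreover have "w' = w" if "point_of_ast_coincidence ast F g w'" for w'
    using that unique[OF _ x] unfolding point_of_ast_coincidence_def w_def by blast
  moreover have "common_ast_fixed_point ast F g w"
    using w gw by (simp add: common_ast_fixed_point_def ast_coincidence_point_def vec_eq_iff)
  moreover have "point_of_ast_coincidence ast F g w'" if "common_ast_fixed_point ast F g w'" for w'
    using that unfolding point_of_ast_coincidence_def
    by (intro exI[of _ w'])
      (simp add: common_ast_fixed_point_def ast_coincidence_point_def vec_eq_iff)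
  ultimately show ?thesis by blast
qed

end
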